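(* For any $n\geq 5$, we have $\theta(K(n,2))=\frac12(n^2-3n+6)$. In particular, if $P$ is the Petersen graph, then $\theta(P)=8$.
   Context: The Kneser graph $K(n,2)$ has as vertices all $2$-element subsets of $\{1,\dots,n\}$, two vertices being adjacent if the corresponding sets are disjoint; the Petersen graph is $K(5,2)$. A vertex coloring of a graph $G$ (not necessarily proper) is distinguishing if the only automorphism of $G$ preserving the color of every vertex is the identity. The distinguishing threshold $\theta(G)$ is the minimum positive integer $t$ such that for every $k\geq t$, every coloring of $G$ with exactly $k$ colors (all $k$ used) is distinguishing. *)

theory Defs
  imports Complex_Main "Graph_Theory.Graph_Theory"
begin

text \<open>
  A finite simple undirected graph is a \<open>pair_graph\<close>: an edge \<open>uv\<close> is represented by
  the two arcs \<open>(u, v)\<close> and \<open>(v, u)\<close>.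
\<close>

definition kneser2 :: "nat \<Rightarrow> nat set pair_pre_digraph" where
  "kneser2 n =
    (let V = {A. A \<subseteq> {1..n} \<and> card A = 2}
     in \<lparr> pverts = V, parcs = {(A, B). A \<in> V \<and> B \<in> V \<and> A \<inter> B = {}} \<rparr>)"

definition petersen_graph :: "nat set pair_pre_digraph" where
  "petersen_graph = kneser2 5"

text \<open>Only the values of \<open>f\<close> on the vertex set are relevant.\<close>

definition graph_automorphism :: "'a pair_pre_digraph \<Rightarrow> ('a \<Rightarrow> 'a) \<Rightarrow> bool" where
  "graph_automorphism G f \<longleftrightarrow>
    bij_betw f (pverts G) (pverts G) \<and>
    (\<forall>u\<in>pverts G. \<forall>v\<in>pverts G. (f u, f v) \<in> parcs G \<longleftrightarrow> (u, v) \<in> parcs G)"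

definition distinguishing :: "'a pair_pre_digraph \<Rightarrow> ('a \<Rightarrow> nat) \<Rightarrow> bool" where
  "distinguishing G c \<longleftrightarrow>
    (\<forall>f. graph_automorphism G f \<and> (\<forall>v\<in>pverts G. c (f v) = c v) \<longrightarrow>
      (\<forall>v\<in>pverts G. f v = v))"

text \<open>
  A coloring with exactly \<open>k\<close> colors is a map from the vertices onto \<open>{1..k}\<close>.
  If \<open>k\<close> exceeds the number of vertices there is none, so for a finite graph the
  minimum below is taken over a nonempty set.
\<close>

definition distinguishing_threshold :: "'a pair_pre_digraph \<Rightarrow> nat" where
  "distinguishing_threshold G =
    (LEAST t. 0 < t \<and>
      (\<forall>k\<ge>t. \<forall>c. c ` pverts G = {1..k} \<longrightarrow> distinguishing G c))"

lemma pair_graph_kneser2: "pair_graph (kneser2 n)"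
proof -
  have verts: "finite (pverts (kneser2 n))"
    by (rule finite_subset[of _ "Pow {1..n}"]) (auto simp: kneser2_def)
  have sub: "parcs (kneser2 n) \<subseteq> pverts (kneser2 n) \<times> pverts (kneser2 n)"
    by (auto simp: kneser2_def)
  have arcs: "finite (parcs (kneser2 n))"
    using finite_subset[OF sub] verts by blast
  have sym: "symmetric (with_proj (kneser2 n))"
    unfolding symmetric_def with_proj_simps by (rule symI) (simp add: kneser2_def Int_commute)
  have noloop: "fst e \<noteq> snd e" if "e \<in> parcs (kneser2 n)" for e
    using that by (auto simp: kneser2_def)
  have ends: "fst e \<in> pverts (kneser2 n)" "snd e \<in> pverts (kneser2 n)"
    if "e \<in> parcs (kneser2 n)" for e
    using that sub by auto
  show ?thesis
    by unfold_locales (fact verts arcs sym noloop ends)+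
qed

lemma graph_automorphism_iff_digraph_isomorphism:
  assumes "pair_wf_digraph G"
  shows "graph_automorphism G f \<longleftrightarrow>
    (\<exists>h. pre_digraph.digraph_isomorphism (with_proj G) h \<and>
      app_iso h (with_proj G) = with_proj G \<and> iso_verts h = f)"
    (is "?L \<longleftrightarrow> ?R")
proof -
  interpret pair_wf_digraph G by (fact assms)
  show ?thesis
  proof
    assume L: ?L
    let ?h = "\<lparr> iso_verts = f, iso_arcs = map_prod f f, iso_head = snd, iso_tail = fst \<rparr>"
    have inj: "inj_on f (pverts G)" and im: "f ` pverts G = pverts G"
      using L by (auto simp: graph_automorphism_def bij_betw_def)
    have sub: "parcs G \<subseteq> pverts G \<times> pverts G"
      using in_arcsD1 in_arcsD2 by (intro subrelI) blast
    have injp: "inj_on (map_prod f f) (parcs G)"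
      by (rule inj_on_subset[OF map_prod_inj_on[OF inj inj] sub])
    have arcs: "map_prod f f ` parcs G = parcs G"
    proof (intro set_eqI iffI)
      fix e assume "e \<in> map_prod f f ` parcs G"
      then show "e \<in> parcs G"
        using L sub unfolding graph_automorphism_def by force
    next
      fix e assume e: "e \<in> parcs G"
      obtain x y where xy: "e = (x, y)" by (cases e)
      have "x \<in> f ` pverts G" "y \<in> f ` pverts G"
        unfolding im using e xy in_arcsD1 in_arcsD2 by blast+
      then obtain u v where uv: "u \<in> pverts G" "v \<in> pverts G" "e = (f u, f v)"
        unfolding xy by blast
      then have "(u, v) \<in> parcs G"
        using e L unfolding graph_automorphism_def by blast
      with uv show "e \<in> map_prod f f ` parcs G" by force
    qed
    have "pre_digraph.digraph_isomorphism (with_proj G) ?h"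
      using inj injp wf_digraph_axioms
      by (auto simp: pre_digraph.digraph_isomorphism_def)
    moreover have "app_iso ?h (with_proj G) = with_proj G"
      using im arcs by (simp add: app_iso_def with_proj_def)
    ultimately show ?R by (intro exI[of _ ?h]) simp
  next
    assume ?R
    then obtain h where h: "pre_digraph.digraph_isomorphism (with_proj G) h"
      "app_iso h (with_proj G) = with_proj G" "iso_verts h = f" by blast
    have im: "f ` pverts G = pverts G" "iso_arcs h ` parcs G = parcs G"
      "iso_tail h = fst" "iso_head h = snd"
      using h(2,3) by (simp_all add: app_iso_def with_proj_def)
    have inj: "inj_on f (pverts G)"
      and ends: "\<And>a. a \<in> parcs G \<Longrightarrow> iso_arcs h a = (f (fst a), f (snd a))"
      using h(1,3) im by (auto simp: pre_digraph.digraph_isomorphism_def prod_eq_iff)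
    have "(f u, f v) \<in> parcs G \<longleftrightarrow> (u, v) \<in> parcs G"
      if uv: "u \<in> pverts G" "v \<in> pverts G" for u v
    proof
      assume "(f u, f v) \<in> parcs G"
      then obtain a where a: "a \<in> parcs G" "iso_arcs h a = (f u, f v)"
        using im(2) by (metis imageE)
      then have "f (fst a) = f u" "f (snd a) = f v" using ends by auto
      then have "fst a = u" "snd a = v"
        using inj_onD[OF inj] uv arc_fst_in_verts[OF a(1)] arc_snd_in_verts[OF a(1)] by blast+
      with a(1) show "(u, v) \<in> parcs G" by (metis prod.collapse)
    next
      assume "(u, v) \<in> parcs G"
      then show "(f u, f v) \<in> parcs G"
        using ends[of "(u, v)"] im(2) by (metis fst_conv imageI snd_conv)
    qed
    then show ?L
      using inj im by (auto simp: graph_automorphism_def bij_betw_def)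
  qed
qed

lemma distinguishing_threshold_exists:
  assumes "finite (pverts G)"
  shows "\<exists>t>0. \<forall>k\<ge>t. \<forall>c. c ` pverts G = {1..k} \<longrightarrow> distinguishing G c"
proof -
  have "distinguishing G c" if "Suc (card (pverts G)) \<le> k" "c ` pverts G = {1..k}" for k c
  proof -
    have "card {1..k} \<le> card (pverts G)"
      unfolding that(2)[symmetric] by (rule card_image_le[OF assms])
    then show ?thesis using that(1) by simp
  qed
  then show ?thesis by (intro exI[of _ "Suc (card (pverts G))"]) blast
qed

end

theory Submission
  imports Defs "HOL-Combinatorics.Transposition"
begin

text \<open>
  Both bounds come from counting the vertices that an automorphism moves. If a coloring is
  preserved by \<open>f\<close>, then each moved vertex \<open>v\<close> shares its color with the other moved vertex
  \<open>f v\<close>; so \<open>f\<close> moving at least \<open>2m\<close> vertices costs at least \<open>m\<close> colors. Conversely, an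
  involution that moves exactly \<open>2m\<close> vertices preserves a coloring with \<open>m\<close> colors fewer than
  there are vertices: color its orbits. Hence the threshold is \<open>|V| - m + 1\<close> as soon as \<open>2m\<close> is
  the least number of vertices moved by a nontrivial automorphism and is attained by an
  involution (\<open>distinguishing_threshold_eqI\<close>).

  For \<open>K(n,2)\<close> one has \<open>m = n - 2\<close>. The transposition of two points of the ground set moves
  \<open>2(n - 2)\<close> pairs. That no nontrivial automorphism \<open>f\<close> moves fewer
  (\<open>kneser2_automorphism_moves_many\<close>) can be seen without knowing the automorphism group: a
  fixed vertex is adjacent to \<open>v\<close> exactly if it is adjacent to \<open>f v\<close>, so a single moved vertex
  \<open>v\<close> forces all vertices adjacent to just one of \<open>v\<close> and \<open>f v\<close> to move as well, and in
  \<open>K(n,2)\<close> there are enough of them.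
\<close>

section \<open>Thresholds from the number of moved vertices\<close>

lemma card_image_le_half:
  assumes "finite M" and "\<And>x. x \<in> M \<Longrightarrow> \<exists>y\<in>M. y \<noteq> x \<and> c y = c x"
  shows "2 * card (c ` M) \<le> card M"
proof -
  have fib: "2 \<le> card {x \<in> M. c x = k}" if k: "k \<in> c ` M" for k
  proof -
    obtain x y where "x \<in> M" "c x = k" "y \<in> M" "y \<noteq> x" "c y = k"
      using assms(2) k by (metis imageE)
    then have "card {x, y} \<le> card {x \<in> M. c x = k}"
      using assms(1) by (intro card_mono) auto
    then show ?thesis using \<open>y \<noteq> x\<close> by simp
  qed
  have "2 * card (c ` M) = (\<Sum>k\<in>c ` M. 2)" by simp
  also have "\<dots> \<le> (\<Sum>k\<in>c ` M. card {x \<in> M. c x = k})" by (rule sum_mono[OF fib])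
  also have "\<dots> = card M"
    using sum.image_gen[OF assms(1), of "\<lambda>_. 1::nat" c] by simp
  finally show ?thesis .
qed

lemma colors_plus_half_moved_le:
  assumes fin: "finite (pverts G)" and aut: "graph_automorphism G f"
    and col: "\<forall>v\<in>pverts G. c (f v) = c v"
  shows "2 * card (c ` pverts G) + card {v \<in> pverts G. f v \<noteq> v} \<le> 2 * card (pverts G)"
proof -
  define M where "M = {v \<in> pverts G. f v \<noteq> v}"
  define F where "F = {v \<in> pverts G. f v = v}"
  have V: "pverts G = M \<union> F" "M \<inter> F = {}" by (auto simp: M_def F_def)
  have finMF: "finite M" "finite F" using fin V by auto
  have card_V: "card (pverts G) = card M + card F"
    using V finMF by (simp add: card_Un_disjoint)
  have bij: "inj_on f (pverts G)" "f ` pverts G = pverts G"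
    using aut by (auto simp: graph_automorphism_def bij_betw_def)
  have "\<exists>y\<in>M. y \<noteq> x \<and> c y = c x" if "x \<in> M" for x
  proof (intro bexI[of _ "f x"] conjI)
    have x: "x \<in> pverts G" "f x \<noteq> x" "f x \<in> pverts G"
      using that bij by (auto simp: M_def)
    then have "f (f x) \<noteq> f x" using inj_onD[OF bij(1)] by blast
    then show "f x \<in> M" "f x \<noteq> x" "c (f x) = c x" using x col by (auto simp: M_def)
  qed
  from card_image_le_half[OF finMF(1) this] have "2 * card (c ` M) \<le> card M" .
  moreover have "card (c ` pverts G) \<le> card (c ` M) + card (c ` F)"
    unfolding V(1) image_Un by (rule card_Un_le)
  moreover have "card (c ` F) \<le> card F" by (rule card_image_le[OF finMF(2)])
  ultimately show ?thesis using card_V unfolding M_def[symmetric] by linarith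
qed

text \<open>
  The set \<open>S\<close> contains one vertex of each two-element orbit of the involution \<open>\<tau>\<close>. Giving the
  vertices outside \<open>S\<close> pairwise different colors, and each vertex of \<open>S\<close> the color of its
  partner, yields a coloring that \<open>\<tau>\<close> preserves.
\<close>

lemma involution_imp_nondistinguishing_coloring:
  assumes fin: "finite (pverts G)" and aut: "graph_automorphism G \<tau>"
    and inv: "\<And>v. v \<in> pverts G \<Longrightarrow> \<tau> (\<tau> v) = v"
    and S: "S \<subseteq> pverts G" "S \<noteq> {}" "\<And>v. v \<in> S \<Longrightarrow> \<tau> v \<notin> S"
    and fixed: "\<And>v. v \<in> pverts G \<Longrightarrow> v \<notin> S \<Longrightarrow> \<tau> v \<notin> S \<Longrightarrow> \<tau> v = v"
  shows "\<exists>c. c ` pverts G = {1..card (pverts G) - card S} \<and> \<not> distinguishing G c"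
proof -
  let ?R = "pverts G - S"
  have finS: "finite S" using fin S(1) by (rule rev_finite_subset)
  have "card ?R = card {1..card (pverts G) - card S}"
    using card_Diff_subset[OF finS S(1)] by simp
  then obtain g where g: "bij_betw g ?R {1..card (pverts G) - card S}"
    using fin by (metis finite_Diff finite_atLeastAtMost finite_same_card_bij)
  define r where "r v = (if v \<in> S then \<tau> v else v)" for v
  have \<tau>V: "\<tau> v \<in> pverts G" if "v \<in> pverts G" for v
    using aut that by (auto simp: graph_automorphism_def bij_betw_def)
  have "r ` pverts G = ?R"
  proof
    show "r ` pverts G \<subseteq> ?R" using S \<tau>V by (auto simp: r_def)
    show "?R \<subseteq> r ` pverts G" by (force simp: r_def)
  qed
  then have im: "(g \<circ> r) ` pverts G = {1..card (pverts G) - card S}"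
    using g unfolding image_comp[symmetric] by (simp add: bij_betw_def)
  have "r (\<tau> v) = r v" if "v \<in> pverts G" for v
    using that S(3) inv fixed by (auto simp: r_def)
  then have "\<forall>v\<in>pverts G. (g \<circ> r) (\<tau> v) = (g \<circ> r) v" by simp
  moreover obtain s where "s \<in> S" using S(2) by blast
  then have "s \<in> pverts G" "\<tau> s \<noteq> s" using S(1) S(3)[of s] by auto
  ultimately have "\<not> distinguishing G (g \<circ> r)"
    using aut unfolding distinguishing_def by blast
  with im show ?thesis by blast
qed

lemma distinguishing_threshold_eqI:
  assumes fin: "finite (pverts G)"
    and moves: "\<And>f v. graph_automorphism G f \<Longrightarrow> v \<in> pverts G \<Longrightarrow> f v \<noteq> v
      \<Longrightarrow> 2 * card S \<le> card {v \<in> pverts G. f v \<noteq> v}"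
    and aut: "graph_automorphism G \<tau>"
    and inv: "\<And>v. v \<in> pverts G \<Longrightarrow> \<tau> (\<tau> v) = v"
    and S: "S \<subseteq> pverts G" "S \<noteq> {}" "\<And>v. v \<in> S \<Longrightarrow> \<tau> v \<notin> S"
    and fixed: "\<And>v. v \<in> pverts G \<Longrightarrow> v \<notin> S \<Longrightarrow> \<tau> v \<notin> S \<Longrightarrow> \<tau> v = v"
  shows "distinguishing_threshold G = card (pverts G) - card S + 1"
  unfolding distinguishing_threshold_def
proof (rule Least_equality, intro conjI allI impI)
  fix k c assume k: "card (pverts G) - card S + 1 \<le> k" and c: "c ` pverts G = {1..k}"
  show "distinguishing G c"
    unfolding distinguishing_def
  proof (intro allI impI ballI, elim conjE, rule ccontr)
    fix f v assume f: "graph_automorphism G f" "\<forall>v\<in>pverts G. c (f v) = c v"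
      and v: "v \<in> pverts G" "f v \<noteq> v"
    show False
      using colors_plus_half_moved_le[OF fin f] moves[OF f(1) v] k c by simp
  qed
next
  fix t assume t: "0 < t \<and> (\<forall>k\<ge>t. \<forall>c. c ` pverts G = {1..k} \<longrightarrow> distinguishing G c)"
  show "card (pverts G) - card S + 1 \<le> t"
    using involution_imp_nondistinguishing_coloring[OF fin aut inv S fixed] t
    by (metis Suc_eq_plus1 not_less_eq_eq)
qed simp

section \<open>Moved vertices in Kneser graphs\<close>

lemma pverts_kneser2: "pverts (kneser2 n) = {A. A \<subseteq> {1..n} \<and> card A = 2}"
  by (simp add: kneser2_def)

lemma parcs_kneser2:
  "(A, B) \<in> parcs (kneser2 n) \<longleftrightarrow>
    A \<in> pverts (kneser2 n) \<and> B \<in> pverts (kneser2 n) \<and> A \<inter> B = {}"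
  by (simp add: kneser2_def)

lemma doubleton_in_pverts_kneser2 [simp]:
  "{a, b} \<in> pverts (kneser2 n) \<longleftrightarrow> a \<in> {1..n} \<and> b \<in> {1..n} \<and> a \<noteq> b"
  by (auto simp: pverts_kneser2 card_2_iff doubleton_eq_iff)

lemma pverts_kneser2_cases:
  assumes "v \<in> pverts (kneser2 n)"
  obtains a b where "v = {a, b}" "a \<noteq> b" "a \<in> {1..n}" "b \<in> {1..n}"
  using assms that by (auto simp: pverts_kneser2 card_2_iff)

lemma pverts_kneser2E:
  assumes v: "v \<in> pverts (kneser2 n)" and a: "a \<in> v"
  obtains b where "v = {a, b}" "a \<noteq> b" "a \<in> {1..n}" "b \<in> {1..n}"
proof -
  obtain x y where xy: "v = {x, y}" "x \<noteq> y" "x \<in> {1..n}" "y \<in> {1..n}"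
    using v by (rule pverts_kneser2_cases)
  from a xy(1) consider "a = x" | "a = y" by blast
  then show thesis
  proof cases
    case 1 then show thesis using that[of y] xy by simp
  next
    case 2 then show thesis using that[of x] xy by (simp add: insert_commute)
  qed
qed

lemma card_insert_image: "card ((\<lambda>k. {a, k}) ` K) = card K" for a :: 'a
  by (rule card_image) (auto simp: inj_on_def doubleton_eq_iff)

text \<open>
  Let \<open>f\<close> move \<open>v\<close> to \<open>w\<close>. If \<open>v = {a, b}\<close> and \<open>w = {a, c}\<close>, then all pairs containing exactly
  one of \<open>b\<close> and \<open>c\<close> move: those not containing \<open>a\<close> are disjoint from exactly one of \<open>v\<close> and
  \<open>w\<close>, and the others are \<open>v\<close> and \<open>w\<close>. This is the bound that transpositions attain. If
  \<open>v = {a, b}\<close> and \<open>w = {c, d}\<close> are disjoint, then all pairs that meet exactly one of them move;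
  for \<open>n \<ge> 5\<close> these are at least as many.
\<close>

lemma kneser2_automorphism_moves_many:
  assumes n: "n \<ge> 5" and aut: "graph_automorphism (kneser2 n) f"
    and v: "v \<in> pverts (kneser2 n)" "f v \<noteq> v"
  shows "2 * (n - 2) \<le> card {v \<in> pverts (kneser2 n). f v \<noteq> v}"
proof -
  let ?V = "pverts (kneser2 n)" and ?M = "{v \<in> pverts (kneser2 n). f v \<noteq> v}"
  have finM: "finite ?M"
    by (rule finite_subset[of _ "Pow {1..n}"]) (auto simp: pverts_kneser2)
  have inj: "inj_on f ?V" and wV: "f v \<in> ?V"
    using aut v by (auto simp: graph_automorphism_def bij_betw_def)
  have w: "f v \<in> ?M"
    using inj_onD[OF inj _ wV v(1)] v wV by auto
  have moved: "x \<in> ?M" if "x \<in> ?V" "(x \<inter> v = {}) \<noteq> (x \<inter> f v = {})" for x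
  proof -
    have "(f x, f v) \<in> parcs (kneser2 n) \<longleftrightarrow> (x, v) \<in> parcs (kneser2 n)"
      using aut v(1) that(1) unfolding graph_automorphism_def by blast
    then have "f x \<noteq> x" using that v(1) wV by (auto simp only: parcs_kneser2)
    then show ?thesis using that(1) by simp
  qed
  show ?thesis
  proof (cases "v \<inter> f v = {}")
    case False
    then obtain a where a: "a \<in> v" "a \<in> f v" by blast
    obtain b where b: "v = {a, b}" "a \<noteq> b" "a \<in> {1..n}" "b \<in> {1..n}"
      using pverts_kneser2E[OF v(1) a(1)] .
    obtain c where c: "f v = {a, c}" "a \<noteq> c" "c \<in> {1..n}"
      using pverts_kneser2E[OF wV a(2)] .
    have bc: "b \<noteq> c" using v(2) b c by auto
    let ?K = "{1..n} - {b, c}"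
    have "{b, k} \<in> ?M" "{c, k} \<in> ?M" if "k \<in> ?K" for k
    proof -
      have "{b, k} \<in> ?M \<and> {c, k} \<in> ?M"
      proof (cases "k = a")
        case True
        then have "{b, k} = v" "{c, k} = f v" using b(1) c(1) by auto
        then show ?thesis using v w by simp
      next
        case False
        then show ?thesis using b c bc that by (intro conjI moved) auto
      qed
      then show "{b, k} \<in> ?M" "{c, k} \<in> ?M" by auto
    qed
    then have sub: "(\<lambda>k. {b, k}) ` ?K \<union> (\<lambda>k. {c, k}) ` ?K \<subseteq> ?M" by blast
    have "card ((\<lambda>k. {b, k}) ` ?K \<union> (\<lambda>k. {c, k}) ` ?K) = card ?K + card ?K"
      using bc
      by (subst card_Un_disjoint) (simp_all add: card_insert_image, auto simp: doubleton_eq_iff)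
    moreover have "card ?K = n - 2" using b c bc by (simp add: card_Diff_subset)
    ultimately show ?thesis using card_mono[OF finM sub] by simp
  next
    case True
    obtain a b where b: "v = {a, b}" "a \<noteq> b" "a \<in> {1..n}" "b \<in> {1..n}"
      using v(1) by (rule pverts_kneser2_cases)
    obtain c d where d: "f v = {c, d}" "c \<noteq> d" "c \<in> {1..n}" "d \<in> {1..n}"
      using wV by (rule pverts_kneser2_cases)
    have dis: "a \<noteq> c" "a \<noteq> d" "b \<noteq> c" "b \<noteq> d" using True b d by auto
    have "card {a, b, c, d} < card {1..n}" using n dis b d by simp
    then have "\<not> {1..n} \<subseteq> {a, b, c, d}"
      by (meson card_mono finite.emptyI finite.insertI not_le)
    then obtain e where e: "e \<in> {1..n}" "e \<notin> {a, b, c, d}" by blast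
    \<comment> \<open>Pairs with \<open>a\<close> and pairs with \<open>c\<close> give \<open>2(n - 3)\<close> moved vertices; a fifth point \<open>e\<close>
      provides the missing two.\<close>
    let ?A = "(\<lambda>k. {a, k}) ` ({1..n} - {a, c, d})" and ?C = "(\<lambda>k. {c, k}) ` ({1..n} - {a, b, c})"
    let ?E = "{{b, e}, {d, e}}"
    have meets_v: "{x, k} \<in> ?M" if "x \<in> {a, b}" "k \<in> {1..n} - {x, c, d}" for x k
    proof (rule moved)
      show "{x, k} \<in> ?V" using that b(3,4) by auto
      show "({x, k} \<inter> v = {}) \<noteq> ({x, k} \<inter> f v = {})"
        unfolding d(1) unfolding b(1) using that dis by auto
    qed
    have meets_w: "{x, k} \<in> ?M" if "x \<in> {c, d}" "k \<in> {1..n} - {x, a, b}" for x k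
    proof (rule moved)
      show "{x, k} \<in> ?V" using that d(3,4) by auto
      show "({x, k} \<inter> v = {}) \<noteq> ({x, k} \<inter> f v = {})"
        unfolding d(1) unfolding b(1) using that dis by auto
    qed
    have "?A \<subseteq> ?M" by (rule image_subsetI, rule meets_v) simp_all
    moreover have "?C \<subseteq> ?M" by (rule image_subsetI, rule meets_w) auto
    moreover have "{b, e} \<in> ?M" by (rule meets_v) (use e in auto)
    moreover have "{d, e} \<in> ?M" by (rule meets_w) (use e in auto)
    ultimately have sub: "?A \<union> ?C \<union> ?E \<subseteq> ?M" by blast
    have disj: "?A \<inter> ?C = {}" "(?A \<union> ?C) \<inter> ?E = {}"
      using dis b(2) d(2) e(2) by (auto simp: doubleton_eq_iff)
    have "card (?A \<union> ?C \<union> ?E) = card ?A + card ?C + card ?E"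
      using disj by (simp only: card_Un_disjoint finite_imageI finite_Diff finite_atLeastAtMost
          finite_UnI finite.intros)
    moreover have "card ?A = n - 3" "card ?C = n - 3"
      unfolding card_insert_image using b d dis by (simp_all add: card_Diff_subset)
    moreover have "card ?E = 2" using dis by (simp add: doubleton_eq_iff)
    ultimately show ?thesis using card_mono[OF finM sub] n by linarith
  qed
qed

section \<open>The automorphism induced by a transposition\<close>

lemma bij_image_graph_automorphism_kneser2:
  assumes "bij_betw \<pi> {1..n} {1..n}"
  shows "graph_automorphism (kneser2 n) ((`) \<pi>)"
proof -
  have inj: "inj_on \<pi> {1..n}" and im: "\<pi> ` {1..n} = {1..n}"
    using assms by (auto simp: bij_betw_def)
  have V: "pverts (kneser2 n) \<subseteq> Pow {1..n}" by (auto simp: pverts_kneser2)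
  have injV: "inj_on ((`) \<pi>) (pverts (kneser2 n))"
    using inj_on_image_Pow[OF inj] V by (rule inj_on_subset)
  have sub: "(`) \<pi> ` pverts (kneser2 n) \<subseteq> pverts (kneser2 n)"
  proof
    fix B assume "B \<in> (`) \<pi> ` pverts (kneser2 n)"
    then obtain A where A: "A \<subseteq> {1..n}" "card A = 2" "B = \<pi> ` A" by (auto simp: pverts_kneser2)
    then have "card B = 2" using card_image[OF inj_on_subset[OF inj]] by simp
    then show "B \<in> pverts (kneser2 n)" using A im by (auto simp: pverts_kneser2)
  qed
  have "(`) \<pi> ` pverts (kneser2 n) = pverts (kneser2 n)"
    using V by (intro endo_inj_surj[OF _ sub injV]) (simp add: finite_subset)
  moreover have "\<pi> ` A \<inter> \<pi> ` B = {} \<longleftrightarrow> A \<inter> B = {}"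
    if "A \<in> pverts (kneser2 n)" "B \<in> pverts (kneser2 n)" for A B
    using inj_on_image_Int[OF inj, of A B] that V by auto
  ultimately show ?thesis
    using injV sub by (auto simp: graph_automorphism_def bij_betw_def parcs_kneser2)
qed

lemma distinguishing_threshold_kneser2:
  assumes n: "n \<ge> 5"
  shows "distinguishing_threshold (kneser2 n) = (n choose 2) - (n - 2) + 1"
proof -
  let ?\<tau> = "(`) (transpose 1 (2::nat))"
  define S where "S = (\<lambda>k. {2, k}) ` {3..n}"
  have S_iff: "v \<in> S \<longleftrightarrow> 2 \<in> v \<and> 1 \<notin> v" if v: "v \<in> pverts (kneser2 n)" for v
  proof
    assume "2 \<in> v \<and> 1 \<notin> v"
    moreover from this obtain k where "v = {2, k}" "2 \<noteq> k" "k \<in> {1..n}"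
      using pverts_kneser2E[OF v] by metis
    ultimately show "v \<in> S" unfolding S_def by (intro image_eqI[of _ _ k]) auto
  qed (auto simp: S_def)
  have aut: "graph_automorphism (kneser2 n) ?\<tau>"
    using n by (intro bij_image_graph_automorphism_kneser2) simp
  then have \<tau>V: "?\<tau> v \<in> pverts (kneser2 n)" if "v \<in> pverts (kneser2 n)" for v
    using that by (auto simp: graph_automorphism_def bij_betw_def)
  have \<tau>_mem: "1 \<in> ?\<tau> v \<longleftrightarrow> 2 \<in> v" "2 \<in> ?\<tau> v \<longleftrightarrow> 1 \<in> v" for v
    by (force simp: image_iff transpose_def split: if_splits)+
  have \<tau>S_iff: "?\<tau> v \<in> S \<longleftrightarrow> 1 \<in> v \<and> 2 \<notin> v" if "v \<in> pverts (kneser2 n)" for v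
    unfolding S_iff[OF \<tau>V[OF that]] \<tau>_mem by blast
  have card_V: "card (pverts (kneser2 n)) = n choose 2"
    using n_subsets[of "{1..n}" 2] by (simp add: pverts_kneser2)
  have card_S: "card S = n - 2" by (simp add: S_def card_insert_image)
  have SV: "S \<subseteq> pverts (kneser2 n)" by (auto simp: S_def)
  have "distinguishing_threshold (kneser2 n) = card (pverts (kneser2 n)) - card S + 1"
  proof (rule distinguishing_threshold_eqI[OF _ _ aut])
    show "finite (pverts (kneser2 n))"
      by (rule finite_subset[of _ "Pow {1..n}"]) (auto simp: pverts_kneser2)
    show "2 * card S \<le> card {v \<in> pverts (kneser2 n). f v \<noteq> v}"
      if "graph_automorphism (kneser2 n) f" "v \<in> pverts (kneser2 n)" "f v \<noteq> v" for f v
      using kneser2_automorphism_moves_many[OF n that] by (simp add: card_S)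
    show "?\<tau> (?\<tau> v) = v" for v
      by (simp only: image_image transpose_involutory image_ident)
    show "S \<subseteq> pverts (kneser2 n)" by (fact SV)
    show "S \<noteq> {}" using n by (simp add: S_def)
    show "?\<tau> v \<notin> S" if "v \<in> S" for v
    proof -
      have v: "v \<in> pverts (kneser2 n)" using SV that by blast
      show ?thesis using that S_iff[OF v] \<tau>S_iff[OF v] by blast
    qed
    show "?\<tau> v = v" if "v \<in> pverts (kneser2 n)" "v \<notin> S" "?\<tau> v \<notin> S" for v
    proof -
      have "1 \<in> v \<longleftrightarrow> 2 \<in> v"
        using that(2,3) S_iff[OF that(1)] \<tau>S_iff[OF that(1)] by blast
      then show ?thesis by (rule transpose_image_eq)
    qed
  qed
  then show ?thesis by (simp only: card_V card_S)
qed

theorem proposition3p4: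
  shows "(\<forall>n\<ge>5. real (distinguishing_threshold (kneser2 n))
            = 1 / 2 * ((real n)\<^sup>2 - 3 * real n + 6))
         \<and> distinguishing_threshold petersen_graph = 8"
proof
  show "\<forall>n\<ge>5. real (distinguishing_threshold (kneser2 n))
            = 1 / 2 * ((real n)\<^sup>2 - 3 * real n + 6)"
  proof (intro allI impI)
    fix n :: nat assume n: "n \<ge> 5"
    have double: "2 * (n choose 2) = n * (n - 1)"
      by (cases "even n") (simp_all add: choose_two)
    have "2 * (n - 2) \<le> n * (n - 1)" using n by (intro mult_mono) auto
    then have "n - 2 \<le> n choose 2" using double by linarith
    moreover have "2 * real (n choose 2) = real n * (real n - 1)"
      using arg_cong[OF double, of real] n by (simp add: of_nat_diff)
    ultimately show "real (distinguishing_threshold (kneser2 n))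
        = 1 / 2 * ((real n)\<^sup>2 - 3 * real n + 6)"
      using n by (simp add: distinguishing_threshold_kneser2 of_nat_diff power2_eq_square
          algebra_simps)
  qed
  show "distinguishing_threshold petersen_graph = 8"
    by (simp add: petersen_graph_def distinguishing_threshold_kneser2 choose_two)
qed

end
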